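(* Let $(\mathcal C,d)$ be a dagger category. There is a fully faithful dagger functor $$\psi\colon(\overline{\mathcal C}^d,d)\longrightarrow(S_{\mathrm{O}(1)}\circ I_{\mathrm{O}(1)}\circ T_{\mathrm{O}(1)})(\mathcal C,d)$$ from the $d$-Karoubi envelope of $(\mathcal C,d)$ to the dagger category obtained from $(\mathcal C,d)$ by applying $T_{\mathrm{O}(1)}$, $I_{\mathrm{O}(1)}$ and $S_{\mathrm{O}(1)}$.
   Context: A dagger category $(\mathcal C,d)$ is a category $\mathcal C$ with a functor $d\colon\mathcal C\to\mathcal C^{\mathrm{op}}$ that is the identity on objects and satisfies $d^{\mathrm{op}}\circ d=\mathrm{id}_{\mathcal C}$. A dagger functor $(\mathcal C,d)\to(\mathcal C',d')$ is a functor $F$ with $F^{\mathrm{op}}\circ d=d'\circ F$. The idempotent completion $I\mathcal C$ has objects $(a,e)$ with $e\colon a\to a$ idempotent, morphisms $(a,e)\to(b,f)$ the morphisms $X\colon a\to b$ with $f\circ X=X=X\circ e$, and $\mathrm{id}_{(a,e)}=e$. The $d$-Karoubi envelope $\overline{\mathcal C}^d$ is the full subcategory of $I\mathcal C$ on objects $(a,e)$ with $d(e)=e$, with dagger structure $(a,e)\mapsto(a,e)$, $X\mapsto d(X)$. An $\mathrm{O}(1)$-volutive category $(\mathcal C,d,\eta)$ is a category with a functor $d\colon\mathcal C\to\mathcal C^{\mathrm{op}}$ and a natural isomorphism $\eta\colon d^{\mathrm{op}}\circ d\Rightarrow\mathrm{id}_{\mathcal C}$ with $d(\eta_a)=\eta_{d(a)}^{-1}$.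 On objects: $T_{\mathrm{O}(1)}(\mathcal C,d)=(\mathcal C,d,\mathrm{id})$. $I_{\mathrm{O}(1)}(\mathcal C,d,\eta)=(I\mathcal C,d',\eta')$ with $d'(a,e)=(d(a),d(e))$, $d'(X)=d(X)$, $\eta'_{(a,e)}=e\circ\eta_a$. $S_{\mathrm{O}(1)}(\mathcal C,d,\eta)$ is the dagger category whose objects are pairs $(a,\theta_a)$ with $\theta_a\colon a\to d(a)$ an isomorphism satisfying $\eta_a\circ d(\theta_a)^{-1}\circ\theta_a=\mathrm{id}_a$, whose morphisms $(a,\theta_a)\to(b,\theta_b)$ are all morphisms $X\colon a\to b$ in $\mathcal C$, and whose dagger of $X$ is $\theta_a^{-1}\circ d(X)\circ\theta_b$. *)

theory Defs
  imports Main
begin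

section \<open>Categories, functors and natural isomorphisms\<close>

text \<open>
  Hom-sets of distinct pairs of objects are not required to be disjoint: in the idempotent
  completion one and the same \<open>X\<close> can be a morphism between many pairs of objects.
  Composition and the action of functors on morphisms therefore take the objects as
  arguments: \<open>cmp C a b c g f\<close> is the composite of \<open>f : a \<rightarrow> b\<close> followed by
  \<open>g : b \<rightarrow> c\<close>, and \<open>on_mor F a b f\<close> is the image of \<open>f : a \<rightarrow> b\<close>.
  Values outside the objects and hom-sets are irrelevant.
\<close>

record ('o, 'm) cat =
  ob  :: "'o set"
  hm  :: "'o \<Rightarrow> 'o \<Rightarrow> 'm set"
  idm :: "'o \<Rightarrow> 'm"
  cmp :: "'o \<Rightarrow> 'o \<Rightarrow> 'o \<Rightarrow> 'm \<Rightarrow> 'm \<Rightarrow> 'm"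

definition category :: "('o, 'm) cat \<Rightarrow> bool" where
  "category C \<longleftrightarrow>
     (\<forall>a\<in>ob C. idm C a \<in> hm C a a) \<and>
     (\<forall>a\<in>ob C. \<forall>b\<in>ob C. \<forall>c\<in>ob C. \<forall>f\<in>hm C a b. \<forall>g\<in>hm C b c. cmp C a b c g f \<in> hm C a c) \<and>
     (\<forall>a\<in>ob C. \<forall>b\<in>ob C. \<forall>f\<in>hm C a b.
        cmp C a b b (idm C b) f = f \<and> cmp C a a b f (idm C a) = f) \<and>
     (\<forall>a\<in>ob C. \<forall>b\<in>ob C. \<forall>c\<in>ob C. \<forall>e\<in>ob C. \<forall>f\<in>hm C a b. \<forall>g\<in>hm C b c. \<forall>h\<in>hm C c e.
        cmp C a c e h (cmp C a b c g f) = cmp C a b e (cmp C b c e h g) f)"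

definition op_cat :: "('o, 'm) cat \<Rightarrow> ('o, 'm) cat" where
  "op_cat C = \<lparr> ob = ob C, hm = (\<lambda>a b. hm C b a), idm = idm C,
                cmp = (\<lambda>a b c g f. cmp C c b a f g) \<rparr>"

definition full_subcategory :: "('o, 'm) cat \<Rightarrow> ('o \<Rightarrow> bool) \<Rightarrow> ('o, 'm) cat" where
  "full_subcategory C P = C\<lparr> ob := {a \<in> ob C. P a} \<rparr>"

definition inverse_pair :: "('o, 'm) cat \<Rightarrow> 'o \<Rightarrow> 'o \<Rightarrow> 'm \<Rightarrow> 'm \<Rightarrow> bool" where
  "inverse_pair C a b f g \<longleftrightarrow> f \<in> hm C a b \<and> g \<in> hm C b a \<and>
     cmp C a b a g f = idm C a \<and> cmp C b a b f g = idm C b"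

definition is_iso :: "('o, 'm) cat \<Rightarrow> 'o \<Rightarrow> 'o \<Rightarrow> 'm \<Rightarrow> bool" where
  "is_iso C a b f \<longleftrightarrow> (\<exists>g. inverse_pair C a b f g)"

definition inv_mor :: "('o, 'm) cat \<Rightarrow> 'o \<Rightarrow> 'o \<Rightarrow> 'm \<Rightarrow> 'm" where
  "inv_mor C a b f = (THE g. inverse_pair C a b f g)"

record ('o, 'm, 'p, 'n) func =
  on_ob  :: "'o \<Rightarrow> 'p"
  on_mor :: "'o \<Rightarrow> 'o \<Rightarrow> 'm \<Rightarrow> 'n"

definition is_functor :: "('o, 'm) cat \<Rightarrow> ('p, 'n) cat \<Rightarrow> ('o, 'm, 'p, 'n) func \<Rightarrow> bool" where
  "is_functor C D F \<longleftrightarrow> category C \<and> category D \<and>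
     (\<forall>a\<in>ob C. on_ob F a \<in> ob D) \<and>
     (\<forall>a\<in>ob C. \<forall>b\<in>ob C. \<forall>f\<in>hm C a b. on_mor F a b f \<in> hm D (on_ob F a) (on_ob F b)) \<and>
     (\<forall>a\<in>ob C. on_mor F a a (idm C a) = idm D (on_ob F a)) \<and>
     (\<forall>a\<in>ob C. \<forall>b\<in>ob C. \<forall>c\<in>ob C. \<forall>f\<in>hm C a b. \<forall>g\<in>hm C b c.
        on_mor F a c (cmp C a b c g f) =
        cmp D (on_ob F a) (on_ob F b) (on_ob F c) (on_mor F b c g) (on_mor F a b f))"

definition id_func :: "('o, 'm, 'o, 'm) func" where
  "id_func = \<lparr> on_ob = (\<lambda>a. a), on_mor = (\<lambda>a b f. f) \<rparr>"

definition comp_func ::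
  "('p, 'n, 'q, 'k) func \<Rightarrow> ('o, 'm, 'p, 'n) func \<Rightarrow> ('o, 'm, 'q, 'k) func" where
  "comp_func G F = \<lparr> on_ob = (\<lambda>a. on_ob G (on_ob F a)),
     on_mor = (\<lambda>a b f. on_mor G (on_ob F a) (on_ob F b) (on_mor F a b f)) \<rparr>"

text \<open>For \<open>F : C \<rightarrow> D\<close>, the functor from \<open>op_cat C\<close> to \<open>op_cat D\<close>.\<close>

definition op_func :: "('o, 'm, 'p, 'n) func \<Rightarrow> ('o, 'm, 'p, 'n) func" where
  "op_func F = \<lparr> on_ob = on_ob F, on_mor = (\<lambda>a b. on_mor F b a) \<rparr>"

text \<open>Equality of functors with domain \<open>C\<close>.\<close>

definition func_eq ::
  "('o, 'm) cat \<Rightarrow> ('o, 'm, 'p, 'n) func \<Rightarrow> ('o, 'm, 'p, 'n) func \<Rightarrow> bool" where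
  "func_eq C F G \<longleftrightarrow> (\<forall>a\<in>ob C. on_ob F a = on_ob G a) \<and>
     (\<forall>a\<in>ob C. \<forall>b\<in>ob C. \<forall>f\<in>hm C a b. on_mor F a b f = on_mor G a b f)"

definition fully_faithful :: "('o, 'm) cat \<Rightarrow> ('p, 'n) cat \<Rightarrow> ('o, 'm, 'p, 'n) func \<Rightarrow> bool" where
  "fully_faithful C D F \<longleftrightarrow> is_functor C D F \<and>
     (\<forall>a\<in>ob C. \<forall>b\<in>ob C. bij_betw (on_mor F a b) (hm C a b) (hm D (on_ob F a) (on_ob F b)))"

definition natural_iso ::
  "('o, 'm) cat \<Rightarrow> ('p, 'n) cat \<Rightarrow> ('o, 'm, 'p, 'n) func \<Rightarrow> ('o, 'm, 'p, 'n) func \<Rightarrow>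
     ('o \<Rightarrow> 'n) \<Rightarrow> bool" where
  "natural_iso C D F G \<eta> \<longleftrightarrow> is_functor C D F \<and> is_functor C D G \<and>
     (\<forall>a\<in>ob C. is_iso D (on_ob F a) (on_ob G a) (\<eta> a)) \<and>
     (\<forall>a\<in>ob C. \<forall>b\<in>ob C. \<forall>f\<in>hm C a b.
        cmp D (on_ob F a) (on_ob F b) (on_ob G b) (\<eta> b) (on_mor F a b f) =
        cmp D (on_ob F a) (on_ob G a) (on_ob G b) (on_mor G a b f) (\<eta> a))"


section \<open>Dagger categories and \<open>O(1)\<close>-volutive categories\<close>

type_synonym ('o, 'm) dagger_data = "('o, 'm) cat \<times> ('o, 'm, 'o, 'm) func"

fun dagger_category :: "('o, 'm) dagger_data \<Rightarrow> bool" where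
  "dagger_category (C, d) \<longleftrightarrow> is_functor C (op_cat C) d \<and>
     (\<forall>a\<in>ob C. on_ob d a = a) \<and>
     func_eq C (comp_func (op_func d) d) id_func"

fun dagger_functor ::
  "('o, 'm) dagger_data \<Rightarrow> ('p, 'n) dagger_data \<Rightarrow> ('o, 'm, 'p, 'n) func \<Rightarrow> bool" where
  "dagger_functor (C, d) (D, d') F \<longleftrightarrow>
     dagger_category (C, d) \<and> dagger_category (D, d') \<and> is_functor C D F \<and>
     func_eq C (comp_func (op_func F) d) (comp_func d' F)"

type_synonym ('o, 'm) volutive_data =
  "('o, 'm) cat \<times> ('o, 'm, 'o, 'm) func \<times> ('o \<Rightarrow> 'm)"

text \<open>
  The component \<open>\<eta> a\<close> is a morphism \<open>d(d(a)) \<rightarrow> a\<close>, so \<open>d(\<eta> a) : d(a) \<rightarrow> d(d(d(a)))\<close>.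
\<close>

fun volutive_category :: "('o, 'm) volutive_data \<Rightarrow> bool" where
  "volutive_category (C, d, \<eta>) \<longleftrightarrow> is_functor C (op_cat C) d \<and>
     natural_iso C C (comp_func (op_func d) d) id_func \<eta> \<and>
     (\<forall>a\<in>ob C. on_mor d (on_ob d (on_ob d a)) a (\<eta> a) =
        inv_mor C (on_ob d (on_ob d (on_ob d a))) (on_ob d a) (\<eta> (on_ob d a)))"


section \<open>Idempotent completion and the \<open>d\<close>-Karoubi envelope\<close>

definition idem_completion :: "('o, 'm) cat \<Rightarrow> ('o \<times> 'm, 'm) cat" where
  "idem_completion C =
     \<lparr> ob = {(a, e). a \<in> ob C \<and> e \<in> hm C a a \<and> cmp C a a a e e = e},
       hm = (\<lambda>(a, e) (b, f). {X \<in> hm C a b. cmp C a b b f X = X \<and> cmp C a a b X e = X}),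
       idm = (\<lambda>(a, e). e),
       cmp = (\<lambda>(a, e) (b, f) (c, g). cmp C a b c) \<rparr>"

fun karoubi_envelope :: "('o, 'm) dagger_data \<Rightarrow> ('o \<times> 'm, 'm) dagger_data" where
  "karoubi_envelope (C, d) =
     (full_subcategory (idem_completion C) (\<lambda>(a, e). on_mor d a a e = e),
      \<lparr> on_ob = (\<lambda>x. x), on_mor = (\<lambda>(a, e) (b, f) X. on_mor d a b X) \<rparr>)"


section \<open>The constructions \<open>T\<close>, \<open>I\<close> and \<open>S\<close> for \<open>O(1)\<close>\<close>

fun T_O1 :: "('o, 'm) dagger_data \<Rightarrow> ('o, 'm) volutive_data" where
  "T_O1 (C, d) = (C, d, idm C)"

fun I_O1 :: "('o, 'm) volutive_data \<Rightarrow> ('o \<times> 'm, 'm) volutive_data" where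
  "I_O1 (C, d, \<eta>) =
     (idem_completion C,
      \<lparr> on_ob = (\<lambda>(a, e). (on_ob d a, on_mor d a a e)),
        on_mor = (\<lambda>(a, e) (b, f) X. on_mor d a b X) \<rparr>,
      (\<lambda>(a, e). cmp C (on_ob d (on_ob d a)) a a e (\<eta> a)))"

text \<open>
  The last condition on \<open>(a, \<theta>)\<close> reads \<open>\<eta> a \<circ> d(\<theta>)\<^sup>-\<^sup>1 \<circ> \<theta> = id\<close>, where
  \<open>d(\<theta>) : d(d(a)) \<rightarrow> d(a)\<close>.
\<close>

fun S_O1 :: "('o, 'm) volutive_data \<Rightarrow> ('o \<times> 'm, 'm) dagger_data" where
  "S_O1 (C, d, \<eta>) =
     (\<lparr> ob = {(a, \<theta>). a \<in> ob C \<and> is_iso C a (on_ob d a) \<theta> \<and>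
          (let da = on_ob d a; dda = on_ob d da in
            cmp C a dda a (\<eta> a)
              (cmp C a da dda (inv_mor C dda da (on_mor d a da \<theta>)) \<theta>) = idm C a)},
        hm = (\<lambda>(a, \<theta>) (b, \<phi>). hm C a b),
        idm = (\<lambda>(a, \<theta>). idm C a),
        cmp = (\<lambda>(a, \<theta>) (b, \<phi>) (c, \<chi>). cmp C a b c) \<rparr>,
      \<lparr> on_ob = (\<lambda>x. x),
        on_mor = (\<lambda>(a, \<theta>) (b, \<phi>) X.
          cmp C b (on_ob d a) a (inv_mor C a (on_ob d a) \<theta>)
            (cmp C b (on_ob d b) (on_ob d a) (on_mor d a b X) \<phi>)) \<rparr>)"

end

theory Submission
  imports Defs
begin

text \<open>
  If \<open>d(e) = e\<close>, then \<open>d'(a, e) = (a, e)\<close> in \<open>I(T(C, d))\<close>, and \<open>e\<close>, the identity of \<open>(a, e)\<close>,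
  is an admissible choice of \<open>\<theta>\<close>. The dagger of \<open>S\<close> formed with these \<open>\<theta>\<close> is just \<open>d\<close>, so
  \<open>\<psi>(a, e) = ((a, e), e)\<close>, acting as the identity on morphisms, is a fully faithful dagger functor.
  That its target is a dagger category follows since \<open>T\<close> and \<open>I\<close> yield volutive categories.
\<close>

section \<open>Category laws, idempotent completion and inverses\<close>

text \<open>Associativity is oriented opposite to \<open>category_def\<close>, so that
  simplification nests all composites to the right.\<close>

lemma cat_id: "category C \<Longrightarrow> a \<in> ob C \<Longrightarrow> idm C a \<in> hm C a a"
  and cat_cmp: "category C \<Longrightarrow> a \<in> ob C \<Longrightarrow> b \<in> ob C \<Longrightarrow> c \<in> ob C \<Longrightarrow>
    f \<in> hm C a b \<Longrightarrow> g \<in> hm C b c \<Longrightarrow> cmp C a b c g f \<in> hm C a c"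
  and cat_idl: "category C \<Longrightarrow> a \<in> ob C \<Longrightarrow> b \<in> ob C \<Longrightarrow> f \<in> hm C a b \<Longrightarrow>
    cmp C a b b (idm C b) f = f"
  and cat_idr: "category C \<Longrightarrow> a \<in> ob C \<Longrightarrow> b \<in> ob C \<Longrightarrow> f \<in> hm C a b \<Longrightarrow>
    cmp C a a b f (idm C a) = f"
  and cat_assoc: "category C \<Longrightarrow> a \<in> ob C \<Longrightarrow> b \<in> ob C \<Longrightarrow> c \<in> ob C \<Longrightarrow> e \<in> ob C \<Longrightarrow>
    f \<in> hm C a b \<Longrightarrow> g \<in> hm C b c \<Longrightarrow> h \<in> hm C c e \<Longrightarrow>
    cmp C a b e (cmp C b c e h g) f = cmp C a c e h (cmp C a b c g f)"
  by (simp_all add: category_def)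

lemmas cat_simps = cat_id cat_cmp cat_idl cat_idr cat_assoc

lemma category_op_cat: "category C \<Longrightarrow> category (op_cat C)"
  by (simp add: category_def op_cat_def)

lemma category_full_subcategory: "category C \<Longrightarrow> category (full_subcategory C P)"
  by (simp add: category_def full_subcategory_def)

lemma category_idem_completion:
  assumes "category C"
  shows "category (idem_completion C)"
proof -
  \<comment> \<open>\<open>k\<close> is absorbed because \<open>k (g f) = (k g) f = g f\<close>, and
    \<open>e\<close> because \<open>(g f) e = g (f e) = g f\<close>. The first chain runs against
    the orientation of \<open>cat_assoc\<close>, hence the explicit instance.\<close>
  have closed: "cmp C a c c k (cmp C a b c g f) = cmp C a b c g f"
      "cmp C a a c (cmp C a b c g f) e = cmp C a b c g f"
    if "a \<in> ob C" "b \<in> ob C" "c \<in> ob C" "f \<in> hm C a b" "g \<in> hm C b c"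
      "e \<in> hm C a a" "k \<in> hm C c c" "cmp C b c c k g = g" "cmp C a a b f e = f"
    for a b c f g e k
    using that cat_assoc[OF assms, of a b c c f g k] by (simp_all add: cat_assoc[OF assms])
  show ?thesis
    unfolding category_def
  proof (intro conjI ballI)
    fix x y z f g
    assume "x \<in> ob (idem_completion C)" "y \<in> ob (idem_completion C)"
      "z \<in> ob (idem_completion C)" "f \<in> hm (idem_completion C) x y"
      "g \<in> hm (idem_completion C) y z"
    then show "cmp (idem_completion C) x y z g f \<in> hm (idem_completion C) x z"
      by (auto simp: idem_completion_def cat_cmp[OF assms] closed)
  qed (auto simp: idem_completion_def cat_assoc[OF assms])
qed

text \<open>Uniqueness of inverses, \<open>h = (g f) h = g (f h) = g\<close>, lets any exhibited
  inverse evaluate the definite description.\<close>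

lemma inv_mor_eq:
  assumes "category C" "a \<in> ob C" "b \<in> ob C" "inverse_pair C a b f g"
  shows "inv_mor C a b f = g"
  unfolding inv_mor_def
proof (rule the_equality)
  fix h assume h: "inverse_pair C a b f h"
  have "h = cmp C b a a (cmp C a b a g f) h"
    using assms h by (simp add: inverse_pair_def cat_idl)
  also have "\<dots> = cmp C b b a g (cmp C b a b f h)"
    using assms h by (intro cat_assoc) (auto simp: inverse_pair_def)
  also have "\<dots> = g"
    using assms h by (simp add: inverse_pair_def cat_idr)
  finally show "h = g" .
qed (rule assms(4))

lemma inverse_pair_inv_mor:
  assumes "category C" "a \<in> ob C" "b \<in> ob C" "is_iso C a b f"
  shows "inverse_pair C a b f (inv_mor C a b f)"
  using assms inv_mor_eq unfolding is_iso_def by metis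

lemma inverse_pair_sym: "inverse_pair C a b f g \<longleftrightarrow> inverse_pair C b a g f"
  by (auto simp: inverse_pair_def)

text \<open>With composites nested to the right, the law \<open>g f = id\<close> is met only in
  front of a further factor \<open>h\<close>.\<close>

lemma inverse_pair_cancel:
  assumes "category C" "x \<in> ob C" "a \<in> ob C" "b \<in> ob C"
    and "inverse_pair C a b f g" "h \<in> hm C x a"
  shows "cmp C x b a g (cmp C x a b f h) = h"
  using assms cat_assoc[of C x a b a h f g] by (simp add: inverse_pair_def cat_idl)

section \<open>Contravariant functors and volutive categories\<close>

lemma is_functor_contra_iff:
  "is_functor C (op_cat C) d \<longleftrightarrow> category C \<and>
     (\<forall>a\<in>ob C. on_ob d a \<in> ob C) \<and>
     (\<forall>a\<in>ob C. \<forall>b\<in>ob C. \<forall>f\<in>hm C a b. on_mor d a b f \<in> hm C (on_ob d b) (on_ob d a)) \<and>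
     (\<forall>a\<in>ob C. on_mor d a a (idm C a) = idm C (on_ob d a)) \<and>
     (\<forall>a\<in>ob C. \<forall>b\<in>ob C. \<forall>c\<in>ob C. \<forall>f\<in>hm C a b. \<forall>g\<in>hm C b c.
        on_mor d a c (cmp C a b c g f) =
        cmp C (on_ob d c) (on_ob d b) (on_ob d a) (on_mor d a b f) (on_mor d b c g))"
  using category_op_cat[of C] by (auto simp: is_functor_def op_cat_def)

lemma is_functor_id: "category C \<Longrightarrow> is_functor C C id_func"
  by (simp add: is_functor_def id_func_def)

lemma is_functor_double:
  assumes "is_functor C (op_cat C) d"
  shows "is_functor C C (comp_func (op_func d) d)"
  using assms unfolding is_functor_contra_iff
  by (simp add: is_functor_def comp_func_def op_func_def)

text \<open>\<open>\<iota> a\<close> is the inverse of \<open>\<eta> a\<close>; the inverse condition on \<open>d(\<eta> a)\<close> thus becomes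
  an equation.\<close>

lemma volutive_category_iff:
  "volutive_category (C, d, \<eta>) \<longleftrightarrow> is_functor C (op_cat C) d \<and>
     (\<exists>\<iota>. (\<forall>a\<in>ob C. inverse_pair C (on_ob d (on_ob d a)) a (\<eta> a) (\<iota> a) \<and>
            on_mor d (on_ob d (on_ob d a)) a (\<eta> a) = \<iota> (on_ob d a)) \<and>
       (\<forall>a\<in>ob C. \<forall>b\<in>ob C. \<forall>f\<in>hm C a b.
          cmp C (on_ob d (on_ob d a)) (on_ob d (on_ob d b)) b (\<eta> b)
            (on_mor d (on_ob d b) (on_ob d a) (on_mor d a b f)) =
          cmp C (on_ob d (on_ob d a)) a b f (\<eta> a)))" (is "?L \<longleftrightarrow> ?R")
proof
  assume L: ?L
  then have F: "is_functor C (op_cat C) d" by simp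
  show ?R
  proof (intro conjI exI[of _ "\<lambda>a. inv_mor C (on_ob d (on_ob d a)) a (\<eta> a)"] ballI)
    fix a assume "a \<in> ob C"
    then show "inverse_pair C (on_ob d (on_ob d a)) a (\<eta> a)
        (inv_mor C (on_ob d (on_ob d a)) a (\<eta> a))"
      using L F by (intro inverse_pair_inv_mor)
        (auto simp: is_functor_contra_iff natural_iso_def comp_func_def op_func_def id_func_def)
  qed (use L in \<open>auto simp: natural_iso_def comp_func_def op_func_def id_func_def\<close>)
next
  assume R: ?R
  then have F: "is_functor C (op_cat C) d" and C: "category C"
    by (auto simp: is_functor_contra_iff)
  from R obtain \<iota> where
    i: "\<And>a. a \<in> ob C \<Longrightarrow> inverse_pair C (on_ob d (on_ob d a)) a (\<eta> a) (\<iota> a)"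
      "\<And>a. a \<in> ob C \<Longrightarrow> on_mor d (on_ob d (on_ob d a)) a (\<eta> a) = \<iota> (on_ob d a)"
    by blast
  have "natural_iso C C (comp_func (op_func d) d) id_func \<eta>"
    using R i(1) is_functor_double[OF F] is_functor_id[OF C]
    by (auto simp: natural_iso_def comp_func_def op_func_def id_func_def is_iso_def)
  moreover have "inv_mor C (on_ob d (on_ob d (on_ob d a))) (on_ob d a) (\<eta> (on_ob d a))
      = \<iota> (on_ob d a)" if "a \<in> ob C" for a
    using that F i(1) by (intro inv_mor_eq C) (auto simp: is_functor_contra_iff)
  ultimately show ?L using F i(2) by simp
qed

text \<open>Identities are their own inverses, so \<open>\<iota>\<close> is \<open>idm C\<close>;
  since \<open>d\<close> fixes objects and squares to the identity, naturality reduces to the unit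
  laws.\<close>

lemma volutive_T_O1:
  assumes "dagger_category (C, d)"
  shows "volutive_category (T_O1 (C, d))"
  using assms unfolding T_O1.simps volutive_category_iff
  by (intro conjI exI[of _ "idm C"])
     (auto simp: is_functor_contra_iff func_eq_def comp_func_def op_func_def id_func_def
       inverse_pair_def cat_simps)

section \<open>Calculations in a volutive category\<close>

text \<open>Fixing the inverse \<open>\<iota>\<close> together with \<open>\<eta>\<close> turns the
  volutive axioms into rewrite rules free of \<open>inv_mor\<close>.\<close>

locale volutive =
  fixes C :: "('o, 'm) cat" and d :: "('o, 'm, 'o, 'm) func" and \<eta> \<iota> :: "'o \<Rightarrow> 'm"
  assumes F: "is_functor C (op_cat C) d"
    and inverse: "a \<in> ob C \<Longrightarrow> inverse_pair C (on_ob d (on_ob d a)) a (\<eta> a) (\<iota> a)"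
    and d_eta: "a \<in> ob C \<Longrightarrow> on_mor d (on_ob d (on_ob d a)) a (\<eta> a) = \<iota> (on_ob d a)"
    and natural: "a \<in> ob C \<Longrightarrow> b \<in> ob C \<Longrightarrow> f \<in> hm C a b \<Longrightarrow>
          cmp C (on_ob d (on_ob d a)) (on_ob d (on_ob d b)) b (\<eta> b)
            (on_mor d (on_ob d b) (on_ob d a) (on_mor d a b f)) =
          cmp C (on_ob d (on_ob d a)) a b f (\<eta> a)"
begin

lemma cat: "category C"
  and d_ob: "a \<in> ob C \<Longrightarrow> on_ob d a \<in> ob C"
  and d_hm: "a \<in> ob C \<Longrightarrow> b \<in> ob C \<Longrightarrow> f \<in> hm C a b \<Longrightarrow>
    on_mor d a b f \<in> hm C (on_ob d b) (on_ob d a)"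
  and d_id: "a \<in> ob C \<Longrightarrow> on_mor d a a (idm C a) = idm C (on_ob d a)"
  and d_cmp: "a \<in> ob C \<Longrightarrow> b \<in> ob C \<Longrightarrow> c \<in> ob C \<Longrightarrow> f \<in> hm C a b \<Longrightarrow> g \<in> hm C b c \<Longrightarrow>
    on_mor d a c (cmp C a b c g f) =
    cmp C (on_ob d c) (on_ob d b) (on_ob d a) (on_mor d a b f) (on_mor d b c g)"
  using F by (simp_all add: is_functor_contra_iff)

lemma eta_hm: "a \<in> ob C \<Longrightarrow> \<eta> a \<in> hm C (on_ob d (on_ob d a)) a"
  and iota_hm: "a \<in> ob C \<Longrightarrow> \<iota> a \<in> hm C a (on_ob d (on_ob d a))"
  and eta_iota: "a \<in> ob C \<Longrightarrow> cmp C a (on_ob d (on_ob d a)) a (\<eta> a) (\<iota> a) = idm C a"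
  and iota_eta: "a \<in> ob C \<Longrightarrow> cmp C (on_ob d (on_ob d a)) a (on_ob d (on_ob d a)) (\<iota> a) (\<eta> a)
    = idm C (on_ob d (on_ob d a))"
  using inverse by (auto simp: inverse_pair_def)

lemmas simps = cat_simps[OF cat] d_ob d_hm d_id d_cmp eta_hm iota_hm eta_iota iota_eta

text \<open>The inverse of a natural isomorphism is natural: insert \<open>\<iota> \<eta>\<close> on
  the left, move \<open>\<eta>\<close> past \<open>?ddf\<close>, then cancel
  \<open>\<eta> \<iota>\<close> on the right.\<close>

lemma natural_iota:
  assumes "a \<in> ob C" "b \<in> ob C" "f \<in> hm C a b"
  shows "cmp C a (on_ob d (on_ob d a)) (on_ob d (on_ob d b))
      (on_mor d (on_ob d b) (on_ob d a) (on_mor d a b f)) (\<iota> a) =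
    cmp C a b (on_ob d (on_ob d b)) (\<iota> b) f" (is "cmp C _ _ _ ?ddf _ = _")
proof -
  let ?A = "on_ob d (on_ob d a)" let ?B = "on_ob d (on_ob d b)"
  have "cmp C a ?A ?B ?ddf (\<iota> a) =
      cmp C a b ?B (\<iota> b) (cmp C a ?B b (\<eta> b) (cmp C a ?A ?B ?ddf (\<iota> a)))"
    using assms by (intro inverse_pair_cancel[OF cat, symmetric] inverse) (simp_all add: simps)
  also have "cmp C a ?B b (\<eta> b) (cmp C a ?A ?B ?ddf (\<iota> a)) =
      cmp C a ?A b (cmp C ?A ?B b (\<eta> b) ?ddf) (\<iota> a)"
    using assms by (intro cat_assoc[OF cat, symmetric]) (simp_all add: simps)
  also have "\<dots> = f"
    using assms by (simp add: natural simps)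
  finally show ?thesis .
qed

text \<open>By contravariance \<open>d(g) d(f) = d(f g)\<close> and
  \<open>d(f) d(g) = d(g f)\<close>, so the two inverse laws change places.\<close>

lemma inverse_pair_dual:
  assumes "a \<in> ob C" "b \<in> ob C" "inverse_pair C a b f g"
  shows "inverse_pair C (on_ob d b) (on_ob d a) (on_mor d a b f) (on_mor d b a g)"
  using assms by (simp add: inverse_pair_def d_hm d_id flip: d_cmp)

end

lemma volutive_category_iff_locale:
  "volutive_category (C, d, \<eta>) \<longleftrightarrow> (\<exists>\<iota>. volutive C d \<eta> \<iota>)"
  unfolding volutive_category_iff volutive_def by blast

section \<open>The volutive structure on the idempotent completion\<close>

text \<open>Since \<open>e\<close> is the identity of \<open>(a, e)\<close>, the map
  \<open>e \<eta>\<close> has inverse \<open>\<iota> e\<close>. The duality condition is inherited: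
  \<open>d(e \<eta>) = d(\<eta>) d(e)\<close>, where \<open>d(\<eta>)\<close> is
  \<open>\<iota>\<close> at \<open>d(a)\<close>.\<close>

lemma volutive_I_O1:
  assumes "volutive_category (C, d, \<eta>)"
  shows "volutive_category (I_O1 (C, d, \<eta>))"
proof -
  from assms obtain \<iota> where "volutive C d \<eta> \<iota>"
    unfolding volutive_category_iff_locale by blast
  then interpret volutive C d \<eta> \<iota> .
  define d' where "d' = \<lparr> on_ob = (\<lambda>(a, e). (on_ob d a, on_mor d a a e)),
        on_mor = (\<lambda>(a, e) (b, f) X. on_mor d a b X) \<rparr>"
  define \<eta>' where "\<eta>' = (\<lambda>(a, e). cmp C (on_ob d (on_ob d a)) a a e (\<eta> a))"
  define \<iota>' where "\<iota>' = (\<lambda>(a, e). cmp C a a (on_ob d (on_ob d a)) (\<iota> a) e)"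
  show ?thesis
    unfolding I_O1.simps volutive_category_iff_locale
    unfolding d'_def[symmetric] \<eta>'_def[symmetric]
  proof (intro exI[of _ \<iota>'] volutive.intro)
    \<comment> \<open>Applying \<open>d\<close> to \<open>e e = e\<close> and
      \<open>f X = X = X e\<close> gives the conditions on objects and morphisms; this is why
      \<open>d_cmp\<close> is used backwards.\<close>
    show "is_functor (idem_completion C) (op_cat (idem_completion C)) d'"
      unfolding is_functor_contra_iff
      using category_idem_completion[OF cat]
      by (auto simp: idem_completion_def d'_def simps simp flip: d_cmp)
  next
    fix x assume "x \<in> ob (idem_completion C)"
    then obtain a e where x: "x = (a, e)" "a \<in> ob C" "e \<in> hm C a a" "cmp C a a a e e = e"
      by (auto simp: idem_completion_def)
    let ?A = "on_ob d (on_ob d a)"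
    let ?dde = "on_mor d (on_ob d a) (on_ob d a) (on_mor d a a e)"
    \<comment> \<open>The rules \<open>ee\<close>, \<open>dde_iota\<close> and
      \<open>eta_iota_cancel\<close> carry a trailing factor \<open>h\<close> so that they apply
      inside right-nested composites.\<close>
    have ee: "cmp C y a a e (cmp C y a a e h) = cmp C y a a e h"
      if "y \<in> ob C" "h \<in> hm C y a" for y h
      using that x cat_assoc[OF cat, of y a a a h e e] by simp
    have dde: "cmp C ?A ?A ?A ?dde ?dde = ?dde"
      using x by (simp add: d_ob d_hm flip: d_cmp)
    have dde_iota: "cmp C y ?A ?A ?dde (cmp C y a ?A (\<iota> a) h) =
        cmp C y a ?A (\<iota> a) (cmp C y a a e h)"
      if "y \<in> ob C" "h \<in> hm C y a" for y h
      using that x cat_assoc[OF cat, of y a ?A ?A h "\<iota> a" ?dde]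
        cat_assoc[OF cat, of y a a ?A h e "\<iota> a"] natural_iota[of a a e]
      by (simp add: d_ob d_hm iota_hm)
    have eta_iota_cancel: "cmp C y ?A a (\<eta> a) (cmp C y a ?A (\<iota> a) h) = h"
      if "y \<in> ob C" "h \<in> hm C y a" for y h
      using that x inverse_pair_cancel[OF cat] inverse[of a]
      by (simp add: inverse_pair_sym[of C a] d_ob)
    \<comment> \<open>The composite \<open>(\<iota> e) (e \<eta>)\<close> shrinks to
      \<open>\<iota> e \<eta>\<close>. Naturality carries \<open>e\<close> across
      \<open>\<eta>\<close>, where it becomes \<open>?dde\<close>, the identity of the double dual
      of \<open>(a, e)\<close>.\<close>
    have "cmp C ?A a ?A (\<iota> a) (cmp C ?A a a e (\<eta> a)) =
        cmp C ?A a ?A (\<iota> a) (cmp C ?A ?A a (\<eta> a) ?dde)"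
      using x by (simp add: natural)
    also have "\<dots> = ?dde"
      using x by (intro inverse_pair_cancel[OF cat] inverse) (simp_all add: d_ob d_hm)
    finally have conj: "cmp C ?A a ?A (\<iota> a) (cmp C ?A a a e (\<eta> a)) = ?dde" .
    show "inverse_pair (idem_completion C) (on_ob d' (on_ob d' x)) x (\<eta>' x) (\<iota>' x)"
      using x by (simp add: inverse_pair_def idem_completion_def d'_def \<eta>'_def \<iota>'_def simps
          natural ee dde dde_iota eta_iota_cancel conj)
    show "on_mor d' (on_ob d' (on_ob d' x)) x (\<eta>' x) = \<iota>' (on_ob d' x)"
      using x by (simp add: d'_def \<eta>'_def \<iota>'_def simps d_eta)
  next
    fix x y X
    assume "x \<in> ob (idem_completion C)" "y \<in> ob (idem_completion C)"
      and "X \<in> hm (idem_completion C) x y"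
    then obtain a e b f where x: "x = (a, e)" "a \<in> ob C" "e \<in> hm C a a"
      and y: "y = (b, f)" "b \<in> ob C" "f \<in> hm C b b"
      and X: "X \<in> hm C a b" "cmp C a b b f X = X" "cmp C a a b X e = X"
      by (auto simp: idem_completion_def)
    let ?A = "on_ob d (on_ob d a)"
    \<comment> \<open>Both sides of the naturality square reduce to \<open>X \<eta>\<close>: the
      left one after \<open>natural\<close>, using \<open>f X = X\<close>, the right one using
      \<open>X e = X\<close>.\<close>
    have "cmp C ?A b b f (cmp C ?A a b X (\<eta> a)) = cmp C ?A a b X (\<eta> a)"
      and "cmp C ?A a b X (cmp C ?A a a e (\<eta> a)) = cmp C ?A a b X (\<eta> a)"
      using x y X cat_assoc[OF cat, of ?A a b b "\<eta> a" X f]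
        cat_assoc[OF cat, of ?A a a b "\<eta> a" e X] by (simp_all add: d_ob eta_hm)
    then show "cmp (idem_completion C) (on_ob d' (on_ob d' x)) (on_ob d' (on_ob d' y)) y (\<eta>' y)
            (on_mor d' (on_ob d' y) (on_ob d' x) (on_mor d' x y X)) =
          cmp (idem_completion C) (on_ob d' (on_ob d' x)) x y X (\<eta>' x)"
      using x y X by (simp add: idem_completion_def d'_def \<eta>'_def simps natural)
  qed
qed

section \<open>The dagger category produced by \<open>S_O1\<close>\<close>

text \<open>Write \<open>\<tau>\<close> for the inverse of \<open>\<theta>\<close>. In a composite
  of two daggers the inner \<open>\<theta> \<tau>\<close> cancels, which gives functoriality. The
  condition on \<open>\<theta>\<close> says \<open>d(\<tau>) \<theta> = \<iota>\<close>; with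
  naturality of \<open>\<iota>\<close> this makes the dagger an involution.\<close>

lemma dagger_S_O1:
  assumes "volutive_category (C, d, \<eta>)"
  shows "dagger_category (S_O1 (C, d, \<eta>))"
proof -
  from assms obtain \<iota> where "volutive C d \<eta> \<iota>"
    unfolding volutive_category_iff_locale by blast
  then interpret volutive C d \<eta> \<iota> .
  obtain S s where Ss: "S_O1 (C, d, \<eta>) = (S, s)" by fastforce
  then have S: "ob S = {(a, \<theta>). a \<in> ob C \<and> is_iso C a (on_ob d a) \<theta> \<and>
      cmp C a (on_ob d (on_ob d a)) a (\<eta> a)
        (cmp C a (on_ob d a) (on_ob d (on_ob d a))
          (inv_mor C (on_ob d (on_ob d a)) (on_ob d a) (on_mor d a (on_ob d a) \<theta>)) \<theta>) = idm C a}"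
      "hm S = (\<lambda>(a, \<theta>) (b, \<phi>). hm C a b)" "idm S = (\<lambda>(a, \<theta>). idm C a)"
      "cmp S = (\<lambda>(a, \<theta>) (b, \<phi>) (c, \<chi>). cmp C a b c)"
    and s: "on_ob s = (\<lambda>x. x)" "on_mor s = (\<lambda>(a, \<theta>) (b, \<phi>) X.
          cmp C b (on_ob d a) a (inv_mor C a (on_ob d a) \<theta>)
            (cmp C b (on_ob d b) (on_ob d a) (on_mor d a b X) \<phi>))"
    by (auto simp: Let_def)
  have catS: "category S"
    using cat by (auto simp: category_def S)
  define \<tau> where "\<tau> = (\<lambda>(a, \<theta>). inv_mor C a (on_ob d a) \<theta>)"
  \<comment> \<open>The inverse of \<open>d(\<theta>)\<close> in the object condition is replaced by
    \<open>d(\<tau>)\<close>, as \<open>d\<close> preserves inverse pairs.\<close>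
  have obS: "a \<in> ob C" "inverse_pair C a (on_ob d a) \<theta> (\<tau> (a, \<theta>))"
      "cmp C a (on_ob d (on_ob d a)) a (\<eta> a)
        (cmp C a (on_ob d a) (on_ob d (on_ob d a)) (on_mor d (on_ob d a) a (\<tau> (a, \<theta>))) \<theta>) = idm C a"
    if "(a, \<theta>) \<in> ob S" for \<theta> a
  proof -
    show a: "a \<in> ob C" using that by (simp add: S)
    show inv: "inverse_pair C a (on_ob d a) \<theta> (\<tau> (a, \<theta>))"
      using that a by (auto simp: S \<tau>_def d_ob intro: inverse_pair_inv_mor[OF cat])
    show "cmp C a (on_ob d (on_ob d a)) a (\<eta> a)
        (cmp C a (on_ob d a) (on_ob d (on_ob d a)) (on_mor d (on_ob d a) a (\<tau> (a, \<theta>))) \<theta>) = idm C a"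
      using inv_mor_eq[OF cat _ _ inverse_pair_dual[OF _ _ inv]] that a by (simp add: S d_ob)
  qed
  have \<tau>_hm: "\<theta> \<in> hm C a (on_ob d a)" "\<tau> (a, \<theta>) \<in> hm C (on_ob d a) a"
      "cmp C a (on_ob d a) a (\<tau> (a, \<theta>)) \<theta> = idm C a"
    if "(a, \<theta>) \<in> ob S" for \<theta> a
    using obS(2)[OF that] by (auto simp: inverse_pair_def)
  have s': "on_mor s (a, \<theta>) (b, \<phi>) X = cmp C b (on_ob d a) a (\<tau> (a, \<theta>))
            (cmp C b (on_ob d b) (on_ob d a) (on_mor d a b X) \<phi>)" for a \<theta> b \<phi> X
    by (simp add: s \<tau>_def)
  have \<theta>\<tau>: "cmp C y a (on_ob d a) \<theta> (cmp C y (on_ob d a) a (\<tau> (a, \<theta>)) h) = h"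
    if "(a, \<theta>) \<in> ob S" "y \<in> ob C" "h \<in> hm C y (on_ob d a)" for a \<theta> y h
    using that(2,3) obS(1,2)[OF that(1)] inverse_pair_cancel[OF cat, of y "on_ob d a" a]
    by (simp add: d_ob inverse_pair_sym[of C a])
  \<comment> \<open>The object condition makes \<open>?l\<close> a right inverse of
    \<open>\<eta> a\<close>; as \<open>\<eta> a\<close> is invertible, \<open>?l\<close> must be
    \<open>\<iota> a\<close>.\<close>
  have iota_eq: "cmp C a (on_ob d a) (on_ob d (on_ob d a))
      (on_mor d (on_ob d a) a (\<tau> (a, \<theta>))) \<theta> = \<iota> a" (is "?l = _") if "(a, \<theta>) \<in> ob S" for \<theta> a
  proof -
    have "?l \<in> hm C a (on_ob d (on_ob d a))"
      using obS(1)[OF that] \<tau>_hm[OF that] by (simp add: simps)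
    then have "?l = cmp C a a (on_ob d (on_ob d a)) (\<iota> a)
        (cmp C a (on_ob d (on_ob d a)) a (\<eta> a) ?l)"
      using obS(1)[OF that] by (intro inverse_pair_cancel[OF cat, symmetric] inverse) (simp_all add: d_ob)
    then show ?thesis using obS(1,3)[OF that] by (simp add: simps)
  qed
  have "is_functor S (op_cat S) s"
    unfolding is_functor_contra_iff
  proof (intro conjI ballI catS)
    fix x assume x: "x \<in> ob S"
    show "on_ob s x \<in> ob S" using x by (simp add: s)
    obtain a \<theta> where a: "x = (a, \<theta>)" by fastforce
    show "on_mor s x x (idm S x) = idm S (on_ob s x)"
      using x obS(1)[of a \<theta>] \<tau>_hm[of a \<theta>] by (simp add: a s' s(1) S(3) simps)
  next
    fix x y X assume xy: "x \<in> ob S" "y \<in> ob S" "X \<in> hm S x y"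
    obtain a \<theta> b \<phi> where a: "x = (a, \<theta>)" "y = (b, \<phi>)" by fastforce
    show "on_mor s x y X \<in> hm S (on_ob s y) (on_ob s x)"
      using xy obS(1)[of a \<theta>] obS(1)[of b \<phi>] \<tau>_hm[of a \<theta>] \<tau>_hm[of b \<phi>]
      by (simp add: a s' s(1) S(2) simps)
  next
    fix x y z X Y
    assume xy: "x \<in> ob S" "y \<in> ob S" "z \<in> ob S" "X \<in> hm S x y" "Y \<in> hm S y z"
    obtain a \<theta> b \<phi> c \<chi> where a: "x = (a, \<theta>)" "y = (b, \<phi>)" "z = (c, \<chi>)" by fastforce
    show "on_mor s x z (cmp S x y z Y X) =
        cmp S (on_ob s z) (on_ob s y) (on_ob s x) (on_mor s x y X) (on_mor s y z Y)"
      using xy obS(1)[of a \<theta>] obS(1)[of b \<phi>] obS(1)[of c \<chi>]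
        \<tau>_hm[of a \<theta>] \<tau>_hm[of b \<phi>] \<tau>_hm[of c \<chi>]
      by (simp add: a s' s(1) S(2,4) simps \<theta>\<tau>)
  qed
  moreover have "on_mor s y x (on_mor s x y X) = X"
    if xy: "x \<in> ob S" "y \<in> ob S" "X \<in> hm S x y" for x y X
  proof -
    obtain a \<theta> b \<phi> where x: "x = (a, \<theta>)" and y: "y = (b, \<phi>)" by fastforce
    have m: "a \<in> ob C" "b \<in> ob C" "X \<in> hm C a b" "(a, \<theta>) \<in> ob S" "(b, \<phi>) \<in> ob S"
      using xy obS(1) by (auto simp: x y S(2))
    note m = m \<tau>_hm[OF m(4)] \<tau>_hm[OF m(5)]
    let ?A = "on_ob d (on_ob d a)" let ?B = "on_ob d (on_ob d b)"
    let ?d\<phi> = "on_mor d b (on_ob d b) \<phi>" let ?d\<tau> = "on_mor d (on_ob d b) b (\<tau> (b, \<phi>))"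
    let ?ddX = "on_mor d (on_ob d b) (on_ob d a) (on_mor d a b X)"
    \<comment> \<open>By \<open>iota_eq\<close> at \<open>(b, \<phi>)\<close>,
      \<open>\<iota> b\<close> factors as \<open>?d\<tau>\<close> after \<open>\<phi>\<close>, and
      \<open>?d\<phi>\<close> cancels \<open>?d\<tau>\<close>.\<close>
    have iota_b: "cmp C a ?B (on_ob d b) ?d\<phi> (cmp C a b ?B (\<iota> b) X) = cmp C a b (on_ob d b) \<phi> X"
    proof -
      have "inverse_pair C (on_ob d b) ?B ?d\<tau> ?d\<phi>"
        using inverse_pair_dual[OF _ _ obS(2)[OF m(5)]] m by (simp add: d_ob inverse_pair_sym[of C ?B])
      then have "cmp C a ?B (on_ob d b) ?d\<phi> (cmp C a (on_ob d b) ?B ?d\<tau> (cmp C a b (on_ob d b) \<phi> X))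
          = cmp C a b (on_ob d b) \<phi> X"
        using m by (intro inverse_pair_cancel[OF cat]) (simp_all add: simps)
      moreover have "cmp C a b ?B (\<iota> b) X = cmp C a (on_ob d b) ?B ?d\<tau> (cmp C a b (on_ob d b) \<phi> X)"
        using m cat_assoc[OF cat, of a b "on_ob d b" ?B X \<phi> ?d\<tau>] by (simp add: simps iota_eq)
      ultimately show ?thesis by simp
    qed
    \<comment> \<open>Expanding \<open>d\<close> of the inner dagger reverses its three factors,
      which places \<open>d(\<tau>)\<close> next to \<open>\<theta>\<close> at the source
      \<open>a\<close>; \<open>iota_eq\<close> merges them into \<open>\<iota> a\<close>.\<close>
    have "on_mor s y x (on_mor s x y X) = cmp C a (on_ob d b) b (\<tau> (b, \<phi>))
        (cmp C a ?B (on_ob d b) ?d\<phi> (cmp C a ?A ?B ?ddX (\<iota> a)))"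
      using m by (simp add: x y s' simps iota_eq)
    also have "\<dots> = cmp C a (on_ob d b) b (\<tau> (b, \<phi>)) (cmp C a b (on_ob d b) \<phi> X)"
      using m by (simp add: natural_iota iota_b)
    also have "\<dots> = X"
      using m by (intro inverse_pair_cancel[OF cat] obS(2)) (simp_all add: d_ob)
    finally show ?thesis .
  qed
  ultimately show ?thesis
    using Ss by (auto simp: s(1) func_eq_def comp_func_def op_func_def id_func_def)
qed

section \<open>The dagger structure of the Karoubi envelope\<close>

text \<open>Self-adjointness of the idempotents keeps \<open>d\<close> within the hom-sets:
  \<open>X e = X\<close> dualises to \<open>d(e) d(X) = d(X)\<close> with \<open>d(e) = e\<close>,
  and likewise for \<open>f X = X\<close>.\<close>

lemma dagger_karoubi_envelope:
  assumes "dagger_category (C, d)"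
  shows "dagger_category (karoubi_envelope (C, d))"
proof -
  have d: "category C" "\<And>a. a \<in> ob C \<Longrightarrow> on_ob d a = a"
      "\<And>a b f. a \<in> ob C \<Longrightarrow> b \<in> ob C \<Longrightarrow> f \<in> hm C a b \<Longrightarrow> on_mor d a b f \<in> hm C b a"
      "\<And>a b c f g. a \<in> ob C \<Longrightarrow> b \<in> ob C \<Longrightarrow> c \<in> ob C \<Longrightarrow> f \<in> hm C a b \<Longrightarrow> g \<in> hm C b c \<Longrightarrow>
        on_mor d a c (cmp C a b c g f) = cmp C c b a (on_mor d a b f) (on_mor d b c g)"
      "\<And>a b f. a \<in> ob C \<Longrightarrow> b \<in> ob C \<Longrightarrow> f \<in> hm C a b \<Longrightarrow> on_mor d b a (on_mor d a b f) = f"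
    using assms by (auto simp: is_functor_contra_iff func_eq_def comp_func_def op_func_def id_func_def)
  obtain K k where Kk: "karoubi_envelope (C, d) = (K, k)" by fastforce
  then have catK: "category K"
    using category_full_subcategory[OF category_idem_completion[OF d(1)]] by auto
  have K: "ob K = {(a, e). a \<in> ob C \<and> e \<in> hm C a a \<and> cmp C a a a e e = e \<and> on_mor d a a e = e}"
      "hm K = (\<lambda>(a, e) (b, f). {X \<in> hm C a b. cmp C a b b f X = X \<and> cmp C a a b X e = X})"
      "idm K = (\<lambda>(a, e). e)" "cmp K = (\<lambda>(a, e) (b, f) (c, g). cmp C a b c)"
    and k: "on_ob k = (\<lambda>x. x)" "on_mor k = (\<lambda>(a, e) (b, f) X. on_mor d a b X)"
    using Kk by (auto simp: full_subcategory_def idem_completion_def)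
  have "on_mor k x y X \<in> hm K y x" if xy: "x \<in> ob K" "y \<in> ob K" "X \<in> hm K x y" for x y X
  proof -
    obtain a e b f where x: "x = (a, e)" "y = (b, f)" by fastforce
    show ?thesis
      using xy d(4)[of a a b e X] d(4)[of a b b X f] by (auto simp: x K k d(3))
  qed
  then have "is_functor K (op_cat K) k"
    unfolding is_functor_contra_iff using catK by (auto simp: K k d(4))
  then show ?thesis
    unfolding Kk by (auto simp: K k d(5) func_eq_def comp_func_def op_func_def id_func_def)
qed

section \<open>The comparison functor from the Karoubi envelope\<close>

theorem proposition3p21:
  fixes C :: "('o, 'm) cat" and d :: "('o, 'm, 'o, 'm) func"
  assumes "dagger_category (C, d)"
  shows "\<exists>\<psi>. dagger_functor (karoubi_envelope (C, d)) ((S_O1 \<circ> I_O1 \<circ> T_O1) (C, d)) \<psi> \<and>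
             fully_faithful (fst (karoubi_envelope (C, d))) (fst ((S_O1 \<circ> I_O1 \<circ> T_O1) (C, d))) \<psi>"
proof -
  let ?I = "idem_completion C"
  have C: "category C" and d_ob: "\<And>a. a \<in> ob C \<Longrightarrow> on_ob d a = a"
    using assms by (auto simp: is_functor_contra_iff)
  have catI: "category ?I" by (rule category_idem_completion[OF C])
  obtain K k where Kk: "karoubi_envelope (C, d) = (K, k)" by fastforce
  obtain d' \<eta> where I: "I_O1 (T_O1 (C, d)) = (?I, d', \<eta>)" by fastforce
  obtain S s where Ss: "S_O1 (?I, d', \<eta>) = (S, s)" by fastforce
  have K: "ob K = {x \<in> ob ?I. on_mor d (fst x) (fst x) (snd x) = snd x}" "hm K = hm ?I"
      "idm K = idm ?I" "cmp K = cmp ?I"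
    and k: "on_ob k = (\<lambda>x. x)" "on_mor k = (\<lambda>(a, e) (b, f) X. on_mor d a b X)"
    using Kk by (auto simp: full_subcategory_def)
  have d': "d' = \<lparr> on_ob = (\<lambda>(a, e). (on_ob d a, on_mor d a a e)),
        on_mor = (\<lambda>(a, e) (b, f) X. on_mor d a b X) \<rparr>"
      and \<eta>: "\<eta> = (\<lambda>(a, e). cmp C (on_ob d (on_ob d a)) a a e (idm C a))"
    using I by auto
  have dagK: "dagger_category (K, k)"
    using dagger_karoubi_envelope[OF assms] unfolding Kk .
  have dagS: "dagger_category (S, s)"
    using dagger_S_O1[of ?I d' \<eta>] volutive_I_O1[of C d "idm C"] volutive_T_O1[OF assms]
    unfolding Ss T_O1.simps I[unfolded T_O1.simps] by blast
  have S: "hm S = (\<lambda>(x, \<theta>) (y, \<phi>). hm ?I x y)" "idm S = (\<lambda>(x, \<theta>). idm ?I x)"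
      "cmp S = (\<lambda>(x, \<theta>) (y, \<phi>) (z, \<chi>). cmp ?I x y z)"
    and s: "on_ob s = (\<lambda>x. x)" "on_mor s = (\<lambda>(a, \<theta>) (b, \<phi>) X.
          cmp ?I b (on_ob d' a) a (inv_mor ?I a (on_ob d' a) \<theta>)
            (cmp ?I b (on_ob d' b) (on_ob d' a) (on_mor d' a b X) \<phi>))"
    using Ss by auto
  \<comment> \<open>On the envelope \<open>d(e) = e\<close> makes \<open>d'\<close> fix the object
    \<open>(a, e)\<close> strictly, and \<open>\<eta>\<close> there is \<open>e\<close> composed
    with an identity, hence the identity \<open>e\<close> of \<open>(a, e)\<close>.\<close>
  have K_ob: "x \<in> ob ?I" "on_ob d' x = x" "on_mor d' x x (idm ?I x) = idm ?I x" "\<eta> x = idm ?I x"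
    if "x \<in> ob K" for x
    using that d_ob C by (auto simp: K d' \<eta> idem_completion_def cat_simps)
  have inv_idm: "inverse_pair ?I x x (idm ?I x) (idm ?I x)" if "x \<in> ob K" for x
    using K_ob(1)[OF that] by (simp add: inverse_pair_def cat_simps[OF catI])
  have inv_mor_idm: "inv_mor ?I x x (idm ?I x) = idm ?I x" if "x \<in> ob K" for x
    using inv_mor_eq[OF catI _ _ inv_idm[OF that]] K_ob(1)[OF that] by simp
  define \<psi> :: "('o \<times> 'm, 'm, ('o \<times> 'm) \<times> 'm, 'm) func"
    where "\<psi> = \<lparr> on_ob = (\<lambda>x. (x, idm ?I x)), on_mor = (\<lambda>x y X. X) \<rparr>"
  \<comment> \<open>With \<open>\<theta>\<close> the identity, every factor in the object condition
    of \<open>S_O1\<close> is an identity of \<open>?I\<close>.\<close>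
  have \<psi>_ob: "(x, idm ?I x) \<in> ob S" if "x \<in> ob K" for x
    using Ss K_ob[OF that] inv_idm[OF that] inv_mor_idm[OF that]
    by (auto simp: Let_def is_iso_def cat_simps[OF catI])
  have \<psi>: "is_functor K S \<psi>"
    using dagK dagS \<psi>_ob by (simp add: is_functor_def \<psi>_def S K)
  moreover have "on_mor s (x, idm ?I x) (y, idm ?I y) X = on_mor k x y X"
    if xy: "x \<in> ob K" "y \<in> ob K" "X \<in> hm K x y" for x y X
  proof -
    \<comment> \<open>This membership permits the unit laws to remove the two identities by which
      the dagger of \<open>S\<close> conjugates \<open>d'\<close>.\<close>
    have "on_mor k x y X \<in> hm ?I y x"
      using dagK xy by (simp add: is_functor_contra_iff k(1) K(2))
    moreover have "on_mor d' x y X = on_mor k x y X" by (simp add: d' k)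
    ultimately show ?thesis
      using xy by (simp add: s K_ob inv_mor_idm cat_simps[OF catI])
  qed
  ultimately have "dagger_functor (K, k) (S, s) \<psi>"
    using dagK dagS by (simp add: func_eq_def comp_func_def op_func_def \<psi>_def s(1) k(1))
  \<comment> \<open>The hom-sets of \<open>K\<close> and \<open>S\<close> are literally those of
    \<open>?I\<close>, so \<open>\<psi>\<close> is the identity map on each of them.\<close>
  moreover have "fully_faithful K S \<psi>"
    using \<psi> by (simp add: fully_faithful_def \<psi>_def S K bij_betw_def)
  ultimately show ?thesis
    unfolding comp_def I Ss Kk fst_conv by blast
qed

end
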